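(* Let $m\ge1$ and let $s:\mathbb R\to\mathcal H$ be a smooth section of $E$ with $m+1$ derivatives. For the canonical Ehresmann connection $\nabla^m$ on the affine bundle $\pi_{m,m-1}:J^m(E)\to J^{m-1}(E)$, given by the splitting $TJ^m(E)=H^m\oplus V^m$, the tangent vector of the prolonged curve $j^m s$ decomposes as $$\frac{d}{d\theta}j^m s=X_H^{(m)}+X_V^{(m)},\qquad X_H^{(m)}=D_\theta^{(m)}\in H^m,\qquad X_V^{(m)}=s^{(m+1)}(\theta)\frac{\partial}{\partial s_m}\in V^m,$$ (all evaluated at $j^m s(\theta)$), and this decomposition into a component in $H^m$ and a component in $V^m$ is unique.
   Context: Let $\mathcal H=L^2(\mu)$ and $E=\mathbb R\times\mathcal H\to\mathbb R$ the trivial bundle, $(\theta,s)\mapsto\theta$. Sections are identified with maps $s:\mathbb R\to\mathcal H$, with $k$-th derivative $s^{(k)}$. The $m$-jet bundle is $J^m(E)=\mathbb R\times\mathcal H^{m+1}$ with coordinates $(\theta,s,s_1,\dots,s_m)$ ($s_0=s$); $\pi_{m,m-1}:J^m(E)\to J^{m-1}(E)$ forgets $s_m$. The prolongation of $s$ is $j^m s(\theta)=(\theta,s(\theta),s^{(1)}(\theta),\dots,s^{(m)}(\theta))$. For $h\in\mathcal H$, $h\,\frac{\partial}{\partial s_k}$ denotes the tangent vector with component $h$ in the $s_k$-slot and zero elsewhere; "$\operatorname{span}$" of $\frac{\partial}{\partial s_k}$ includes all $h\,\frac{\partial}{\partial s_k}$, $h\in\mathcal H$. The total derivative vector field is $$D^{(m)}_\theta=\frac{\partial}{\partial\theta}+s_1\frac{\partial}{\partial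 s}+s_2\frac{\partial}{\partial s_1}+\cdots+s_m\frac{\partial}{\partial s_{m-1}}.$$ The canonical Ehresmann connection $\nabla^m$ is defined by the horizontal subbundle $$H^m=\operatorname{span}\Bigl\{D_\theta^{(m)},\frac{\partial}{\partial s},\frac{\partial}{\partial s_1},\dots,\frac{\partial}{\partial s_{m-1}}\Bigr\},$$ and the vertical bundle is $V^m=\ker((\pi_{m,m-1})_* )=\operatorname{span}\{\frac{\partial}{\partial s_m}\}$. *)

theory Defs
  imports "HOL-Analysis.Analysis"
begin

definition square_integrable :: "'a measure \<Rightarrow> ('a \<Rightarrow> real) set" where
  "square_integrable M = {f \<in> borel_measurable M. integrable M (\<lambda>x. (f x)\<^sup>2)}"

text \<open>
  A type cannot depend on the measure \<open>M\<close>, so \<open>L\<^sup>2(M)\<close> is given by a type \<open>'h\<close> together with the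
  map \<open>cls\<close> sending a square-integrable function to its class modulo equality almost everywhere.
  The clauses say that \<open>'h\<close> is exactly the set of these classes, with pointwise operations and
  inner product \<open>\<integral> f g dM\<close>.  (The values of \<open>cls\<close> on other functions are irrelevant.)
\<close>

definition is_L2_space :: "'a measure \<Rightarrow> (('a \<Rightarrow> real) \<Rightarrow> 'h::real_inner) \<Rightarrow> bool" where
  "is_L2_space M cls \<longleftrightarrow>
     cls ` square_integrable M = UNIV \<and>
     (\<forall>f\<in>square_integrable M. \<forall>g\<in>square_integrable M.
        (cls f = cls g \<longleftrightarrow> (AE x in M. f x = g x)) \<and>
        cls (\<lambda>x. f x + g x) = cls f + cls g \<and>
        (\<forall>c. cls (\<lambda>x. c * f x) = c *\<^sub>R cls f) \<and>
        cls f \<bullet> cls g = (\<integral>x. f x * g x \<partial>M))"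

definition nth_derivative :: "nat \<Rightarrow> (real \<Rightarrow> 'h::real_normed_vector) \<Rightarrow> real \<Rightarrow> 'h" where
  "nth_derivative k s = ((\<lambda>f \<theta>. vector_derivative f (at \<theta>)) ^^ k) s"

definition times_differentiable :: "nat \<Rightarrow> (real \<Rightarrow> 'h::real_normed_vector) \<Rightarrow> bool" where
  "times_differentiable n s \<longleftrightarrow> (\<forall>k<n. \<forall>\<theta>. nth_derivative k s differentiable (at \<theta>))"

text \<open>
  \<open>J\<^sup>m(E) = \<real> \<times> \<H>\<^bsup>m+1\<^esup>\<close> is the type \<open>('h, 'k) jet\<close> for a finite linearly ordered index type \<open>'k\<close> with
  \<open>CARD('k) = m + 1\<close>.  The slots \<open>0, \<dots>, m\<close> are the elements of \<open>'k\<close> in increasing order.  The jet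
  space is a normed vector space, so each of its tangent spaces is the type itself.
\<close>

type_synonym ('h, 'k) jet = "real \<times> ('h ^ 'k)"

definition slot_number :: "'k::{finite,linorder} \<Rightarrow> nat" where
  "slot_number i = card {j. j < i}"

text \<open>\<open>slot k\<close> is meaningful only for \<open>k < CARD('k)\<close>.\<close>

definition slot :: "nat \<Rightarrow> 'k::{finite,linorder}" where
  "slot k = inv slot_number k"

definition jet_coord :: "('h, 'k::{finite,linorder}) jet \<Rightarrow> nat \<Rightarrow> 'h" where
  "jet_coord p k = snd p $ slot k"

text \<open>Only the first \<open>CARD('k)\<close> entries of \<open>x\<close> are used.\<close>

definition mk_jet :: "real \<Rightarrow> (nat \<Rightarrow> 'h) \<Rightarrow> ('h, 'k::{finite,linorder}) jet" where
  "mk_jet \<theta> x = (\<theta>, \<chi> i. x (slot_number i))"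

lemma slot_number_bij: "bij_betw (slot_number :: 'k::{finite,linorder} \<Rightarrow> nat) UNIV {..<CARD('k)}"
proof -
  have less: "slot_number i < slot_number j" if "i < j" for i j :: 'k
    unfolding slot_number_def by (rule psubset_card_mono) (use that in auto)
  have inj: "inj (slot_number :: 'k \<Rightarrow> nat)"
    by (rule injI) (metis less less_irrefl linorder_neqE)
  have "slot_number i < CARD('k)" for i :: 'k
    unfolding slot_number_def by (rule psubset_card_mono) auto
  then have "range (slot_number :: 'k \<Rightarrow> nat) \<subseteq> {..<CARD('k)}"
    by auto
  then have "range (slot_number :: 'k \<Rightarrow> nat) = {..<CARD('k)}"
    by (rule card_subset_eq[rotated]) (simp_all add: card_image[OF inj])
  with inj show ?thesis
    by (simp add: bij_betw_def)
qed

lemma slot_slot_number [simp]: "slot (slot_number i) = i"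
  unfolding slot_def using slot_number_bij bij_betw_imp_inj_on inv_f_f by metis

lemma slot_number_slot [simp]:
  "k < CARD('k) \<Longrightarrow> slot_number (slot k :: 'k::{finite,linorder}) = k"
  unfolding slot_def using slot_number_bij[where 'k = 'k]
  by (metis bij_betw_imp_surj_on f_inv_into_f lessThan_iff)

lemma fst_mk_jet [simp]: "fst (mk_jet \<theta> x) = \<theta>"
  by (simp add: mk_jet_def)

lemma jet_coord_mk_jet [simp]:
  "k < CARD('k) \<Longrightarrow> jet_coord (mk_jet \<theta> x :: ('h, 'k::{finite,linorder}) jet) k = x k"
  by (simp add: jet_coord_def mk_jet_def)

lemma mk_jet_jet_coord [simp]: "mk_jet (fst p) (jet_coord p) = p"
  by (simp add: mk_jet_def jet_coord_def prod_eq_iff vec_eq_iff)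

text \<open>Intended for \<open>CARD('k) = CARD('l) + 1\<close>, where it forgets the last slot.\<close>

definition jet_proj :: "('h, 'k::{finite,linorder}) jet \<Rightarrow> ('h, 'l::{finite,linorder}) jet" where
  "jet_proj p = mk_jet (fst p) (jet_coord p)"

definition prolongation ::
    "(real \<Rightarrow> 'h::real_normed_vector) \<Rightarrow> real \<Rightarrow> ('h, 'k::{finite,linorder}) jet" where
  "prolongation s \<theta> = mk_jet \<theta> (\<lambda>k. nth_derivative k s \<theta>)"

definition d_theta :: "('h::real_normed_vector, 'k::{finite,linorder}) jet" where
  "d_theta = (1, 0)"

text \<open>\<open>d_slot k h\<close> is the tangent vector \<open>h \<partial>/\<partial>s\<^sub>k\<close>.\<close>

definition d_slot :: "nat \<Rightarrow> 'h::real_normed_vector \<Rightarrow> ('h, 'k::{finite,linorder}) jet" where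
  "d_slot k h = (0, axis (slot k) h)"

definition total_derivative ::
    "nat \<Rightarrow> ('h::real_normed_vector, 'k::{finite,linorder}) jet \<Rightarrow> ('h, 'k) jet" where
  "total_derivative m p = d_theta + (\<Sum>k<m. d_slot k (jet_coord p (Suc k)))"

definition horizontal ::
    "nat \<Rightarrow> ('h::real_normed_vector, 'k::{finite,linorder}) jet \<Rightarrow> ('h, 'k) jet set" where
  "horizontal m p = span (insert (total_derivative m p) {d_slot k h | k h. k < m})"

definition vertical :: "('p::real_normed_vector \<Rightarrow> 'q::real_normed_vector) \<Rightarrow> 'p \<Rightarrow> 'p set" where
  "vertical \<pi> p = {v. frechet_derivative \<pi> (at p) v = 0}"

text \<open>Closedness of the summands is part of the notion because the spaces are infinite-dimensional.\<close>

definition direct_sum_decomposition :: "'p::real_normed_vector set \<Rightarrow> 'p set \<Rightarrow> bool" where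
  "direct_sum_decomposition H V \<longleftrightarrow>
     subspace H \<and> closed H \<and> subspace V \<and> closed V \<and>
     H \<inter> V = {0} \<and> {x + y | x y. x \<in> H \<and> y \<in> V} = UNIV"

end

theory Submission
  imports Defs
begin

text \<open>
  Since \<open>D\<^sub>\<theta>\<close> has no component in the last slot, the horizontal space is \<open>{v. v\<^sub>m = 0}\<close>, while the
  vertical space is the kernel of the continuous linear map \<open>\<pi>\<close>, namely the vectors with only the last
  slot.  These are complementary closed subspaces, and the derivative of the prolongation is computed
  slot by slot.
\<close>

section \<open>Linear maps and derivatives into finite powers of a normed space\<close>

lemma bounded_linear_axis: "bounded_linear (axis i :: 'a::real_normed_vector \<Rightarrow> 'a ^ 'n)"
proof (rule bounded_linear_intro)
  show "norm (axis i x :: 'a ^ 'n) \<le> norm x * 1" for x :: 'a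
    unfolding norm_vec_def
    \<comment> \<open>The Euclidean norm is at most the sum of the component norms, and only
      component \<open>i\<close> contributes.\<close>
    by (rule order.trans[OF L2_set_le_sum]) (simp_all add: axis_def if_distrib cong: if_cong)
qed (simp_all add: axis_def vec_eq_iff)

text \<open>Turns vector-valued maps into finite sums of one-component maps, so that linearity and
  differentiability can be checked componentwise.\<close>

lemma vec_lambda_eq_sum_axis: "(\<chi> i. f i) = (\<Sum>i\<in>UNIV. axis i (f i :: 'a::comm_monoid_add))"
  by (simp add: vec_eq_iff axis_def if_distrib cong: if_cong)

lemma bounded_linear_vec_lambda:
  assumes "\<And>i. bounded_linear (\<lambda>x. f x i)"
  shows "bounded_linear (\<lambda>x. \<chi> i. f x i)"
  unfolding vec_lambda_eq_sum_axis
  by (intro bounded_linear_sum bounded_linear_compose[OF bounded_linear_axis] assms)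

lemma has_vector_derivative_vec_lambda:
  assumes "\<And>i. ((\<lambda>t. f t i) has_vector_derivative f' i) F"
  shows "((\<lambda>t. \<chi> i. f t i) has_vector_derivative (\<chi> i. f' i)) F"
  unfolding vec_lambda_eq_sum_axis
  by (intro has_vector_derivative_sum bounded_linear.has_vector_derivative[OF bounded_linear_axis] assms)

section \<open>Coordinates of jets and of tangent vectors\<close>

lemma jet_eqI:
  fixes p q :: "('h, 'k::{finite,linorder}) jet"
  assumes "fst p = fst q" and "\<And>k. k < CARD('k) \<Longrightarrow> jet_coord p k = jet_coord q k"
  shows "p = q"
proof -
  have "snd p $ i = snd q $ i" for i
    using assms(2)[of "slot_number i"] slot_number_bij[where 'k = 'k]
    by (auto simp: jet_coord_def bij_betw_def)
  with assms(1) show ?thesis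
    by (simp add: prod_eq_iff vec_eq_iff)
qed

lemma jet_coord_add [simp]: "jet_coord (p + q) k = jet_coord p k + jet_coord q k"
  and jet_coord_diff [simp]: "jet_coord (p - q) k = jet_coord p k - jet_coord q k"
  and jet_coord_scaleR [simp]: "jet_coord (c *\<^sub>R p) k = c *\<^sub>R jet_coord p k"
  and jet_coord_zero [simp]: "jet_coord 0 k = 0"
  by (simp_all add: jet_coord_def)

lemma jet_coord_sum [simp]:
  fixes f :: "'a \<Rightarrow> ('h::real_normed_vector, 'k::{finite,linorder}) jet"
  shows "jet_coord (\<Sum>i\<in>A. f i) k = (\<Sum>i\<in>A. jet_coord (f i) k)"
  by (induction A rule: infinite_finite_induct) simp_all

lemma jet_coord_d_theta [simp]: "jet_coord d_theta k = 0"
  and fst_d_theta [simp]: "fst d_theta = 1"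
  and fst_d_slot [simp]: "fst (d_slot k h) = 0"
  by (simp_all add: jet_coord_def d_theta_def d_slot_def)

text \<open>Both bounds enter through the injectivity of \<open>slot\<close>, which is guaranteed
  only below \<open>CARD('k)\<close>.\<close>

lemma jet_coord_d_slot [simp]:
  assumes "j < CARD('k)" "k < CARD('k)"
  shows "jet_coord (d_slot k h :: ('h::real_normed_vector, 'k::{finite,linorder}) jet) j = (if j = k then h else 0)"
proof -
  have "slot j = (slot k :: 'k) \<longleftrightarrow> j = k"
    using assms by (metis slot_number_slot)
  then show ?thesis
    by (auto simp: jet_coord_def d_slot_def axis_def)
qed

lemma fst_total_derivative [simp]: "fst (total_derivative m p) = 1"
  by (simp add: total_derivative_def fst_sum)

lemma jet_coord_total_derivative [simp]:
  fixes p :: "('h::real_normed_vector, 'k::{finite,linorder}) jet"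
  assumes "m < CARD('k)" "j < CARD('k)"
  shows "jet_coord (total_derivative m p) j = (if j < m then jet_coord p (Suc j) else 0)"
proof -
  have "jet_coord (total_derivative m p) j = (\<Sum>k<m. if j = k then jet_coord p (Suc k) else 0)"
    using assms by (simp add: total_derivative_def)
  then show ?thesis
    by (simp cong: if_cong)
qed

section \<open>The horizontal and vertical subspaces and their splitting\<close>

lemma horizontal_eq:
  fixes p :: "('h::real_normed_vector, 'k::{finite,linorder}) jet"
  assumes card: "CARD('k) = m + 1"
  shows "horizontal m p = {v. jet_coord v m = 0}"
proof
  have "subspace {v :: ('h, 'k) jet. jet_coord v m = 0}"
    by (simp add: subspace_def)
  then show "horizontal m p \<subseteq> {v. jet_coord v m = 0}"
    unfolding horizontal_def by (intro span_minimal) (auto simp: card)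
next
  show "{v. jet_coord v m = 0} \<subseteq> horizontal m p"
  proof
    fix v :: "('h, 'k) jet"
    assume v: "v \<in> {v. jet_coord v m = 0}"
    \<comment> \<open>The \<open>\<theta>\<close>-component forces the coefficient
      \<open>fst v\<close> of the total derivative; \<open>c k\<close> is what then remains in slot
      \<open>k\<close>.\<close>
    define c where "c k = jet_coord v k - fst v *\<^sub>R jet_coord p (Suc k)" for k
    have "v = fst v *\<^sub>R total_derivative m p + (\<Sum>k<m. d_slot k (c k))"
    proof (rule jet_eqI)
      fix j
      assume j: "j < CARD('k)"
      have "jet_coord (\<Sum>k<m. d_slot k (c k) :: ('h, 'k) jet) j = (\<Sum>k<m. if j = k then c k else 0)"
        using j card by simp
      \<comment> \<open>At \<open>j = m\<close> both summands vanish, in agreement with the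
        assumption on \<open>v\<close>; for \<open>j < m\<close> the term \<open>c j\<close> makes
        up the difference.\<close>
      then show "jet_coord v j = jet_coord (fst v *\<^sub>R total_derivative m p + (\<Sum>k<m. d_slot k (c k))) j"
        using j card v by (cases "j = m") (auto simp: c_def simp del: jet_coord_sum)
    qed (simp add: fst_sum)
    also have "\<dots> \<in> horizontal m p"
      unfolding horizontal_def by (intro span_add span_scale span_sum span_base) auto
    finally show "v \<in> horizontal m p" .
  qed
qed

lemma bounded_linear_jet_coord:
  "bounded_linear (\<lambda>p :: ('h::real_normed_vector, 'k::{finite,linorder}) jet. jet_coord p k)"
  unfolding jet_coord_def
  by (rule bounded_linear_compose[OF bounded_linear_vec_nth bounded_linear_snd])

lemma bounded_linear_jet_proj:
  "bounded_linear (jet_proj :: ('h::real_normed_vector, 'k::{finite,linorder}) jet \<Rightarrow> ('h, 'l::{finite,linorder}) jet)"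
proof -
  have "bounded_linear (\<lambda>p :: ('h, 'k) jet. (jet_proj p :: ('h, 'l) jet))"
    unfolding jet_proj_def mk_jet_def
    by (intro bounded_linear_Pair bounded_linear_fst bounded_linear_vec_lambda bounded_linear_jet_coord)
  then show ?thesis .
qed

text \<open>A bounded linear map is its own Frechet derivative at every point, so the vertical space
  is one fixed kernel.\<close>

lemma vertical_bounded_linear:
  assumes "bounded_linear f"
  shows "vertical f p = {v. f v = 0}"
  unfolding vertical_def frechet_derivative_at[OF bounded_linear_imp_has_derivative[OF assms], symmetric] ..

lemma closed_bounded_linear_kernel:
  assumes "bounded_linear f"
  shows "closed {v. f v = 0}"
  by (intro closed_Collect_eq bounded_linear.continuous_on[OF assms] continuous_intros)

text \<open>\<open>jet_proj\<close> matches slots by number, so it vanishes exactly when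
  \<open>\<theta>\<close> and all slots known to the target vanish. When \<open>CARD('l) = m\<close>
  and \<open>CARD('k) = m + 1\<close>, only slot \<open>m\<close> stays free.\<close>

lemma vertical_jet_proj:
  fixes p :: "('h::real_normed_vector, 'k::{finite,linorder}) jet"
  shows "vertical (jet_proj :: ('h, 'k) jet \<Rightarrow> ('h, 'l::{finite,linorder}) jet) p =
    {v. fst v = 0 \<and> (\<forall>k<CARD('l). jet_coord v k = 0)}"
proof -
  have "jet_proj v = (0 :: ('h, 'l) jet) \<longleftrightarrow> fst v = 0 \<and> (\<forall>k<CARD('l). jet_coord v k = 0)"
    for v :: "('h, 'k) jet"
  proof
    assume "jet_proj v = (0 :: ('h, 'l) jet)"
    then have v: "mk_jet (fst v) (jet_coord v) = (0 :: ('h, 'l) jet)"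
      by (simp add: jet_proj_def)
    have "jet_coord v k = 0" if "k < CARD('l)" for k
      using jet_coord_mk_jet[OF that, of "fst v" "jet_coord v"] by (simp add: v)
    moreover have "fst v = 0"
      using fst_mk_jet[where 'b = 'l, of "fst v" "jet_coord v"] by (simp add: v)
    ultimately show "fst v = 0 \<and> (\<forall>k<CARD('l). jet_coord v k = 0)"
      by simp
  qed (auto intro!: jet_eqI simp: jet_proj_def)
  then show ?thesis
    by (simp add: vertical_bounded_linear[OF bounded_linear_jet_proj])
qed

lemma direct_sum_horizontal_vertical:
  fixes p :: "('h::real_normed_vector, 'k::{finite,linorder}) jet"
  assumes k: "CARD('k) = m + 1" and l: "CARD('l::{finite,linorder}) = m"
  shows "direct_sum_decomposition (horizontal m p) (vertical (jet_proj :: ('h, 'k) jet \<Rightarrow> ('h, 'l) jet) p)"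
    (is "direct_sum_decomposition ?H ?V")
proof -
  note H = horizontal_eq[OF k, of p]
  note V = vertical_jet_proj[where 'l = 'l, of p, unfolded l]
  have "closed ?H"
    unfolding H by (rule closed_bounded_linear_kernel[OF bounded_linear_jet_coord])
  moreover have "closed ?V"
    unfolding vertical_bounded_linear[OF bounded_linear_jet_proj]
    by (rule closed_bounded_linear_kernel[OF bounded_linear_jet_proj])
  moreover have "subspace ?H" "subspace ?V"
    unfolding H V by (simp_all add: subspace_def)
  \<comment> \<open>Horizontality kills slot \<open>m\<close> and verticality kills everything else,
    so every coordinate is zero.\<close>
  moreover have "?H \<inter> ?V = {0}"
    unfolding H V using k by (auto intro!: jet_eqI simp: less_Suc_eq)
  moreover have "v \<in> {x + y | x y. x \<in> ?H \<and> y \<in> ?V}" for v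
    unfolding mem_Collect_eq
  proof (intro exI conjI)
    \<comment> \<open>The vertical part must carry the whole last slot, since horizontal vectors
      have none.\<close>
    let ?y = "d_slot m (jet_coord v m)"
    show "v = (v - ?y) + ?y"
      by simp
    show "v - ?y \<in> ?H"
      using k by (simp add: H)
    show "?y \<in> ?V"
      using k by (simp add: V)
  qed
  ultimately show ?thesis
    unfolding direct_sum_decomposition_def by (intro conjI UNIV_eq_I[symmetric])
qed

text \<open>The difference of two decompositions lies in both summands, which meet only in
  zero.\<close>

lemma direct_sum_decomposition_unique:
  assumes "direct_sum_decomposition H V" "x \<in> H" "x' \<in> H" "y \<in> V" "y' \<in> V" "x + y = x' + y'"
  shows "x = x' \<and> y = y'"
proof -
  have "subspace H" "subspace V" and HV: "H \<inter> V = {0}"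
    using assms(1) by (simp_all add: direct_sum_decomposition_def)
  then have "x - x' \<in> H" "y' - y \<in> V"
    using assms(2-5) by (simp_all add: subspace_diff)
  moreover have eq: "x - x' = y' - y"
    using assms(6) by (simp add: algebra_simps)
  ultimately have "x - x' \<in> H \<inter> V"
    by simp
  with eq show ?thesis
    by (simp add: HV)
qed

section \<open>The velocity of the prolonged curve\<close>

lemma has_vector_derivative_nth_derivative:
  assumes "times_differentiable n s" "k < n"
  shows "(nth_derivative k s has_vector_derivative nth_derivative (Suc k) s \<theta>) (at \<theta>)"
  using assms by (simp add: times_differentiable_def nth_derivative_def flip: vector_derivative_works)

text \<open>Differentiation shifts the slots by one. Below \<open>m\<close> the shifted values are
  again coordinates of the jet and form the total derivative; the derivative of order
  \<open>m + 1\<close> in slot \<open>m\<close> is not a coordinate and gives the vertical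
  term.\<close>

lemma has_vector_derivative_prolongation:
  fixes s :: "real \<Rightarrow> 'h::real_normed_vector"
  assumes k: "CARD('k::{finite,linorder}) = m + 1" and s: "times_differentiable (m + 1) s"
  shows "((prolongation s :: real \<Rightarrow> ('h, 'k) jet) has_vector_derivative
    total_derivative m (prolongation s \<theta>) + d_slot m (nth_derivative (m + 1) s \<theta>)) (at \<theta>)"
proof -
  \<comment> \<open>The slots hold derivatives of order at most \<open>m\<close>, precisely those
    that \<open>times_differentiable (m + 1) s\<close> makes differentiable.\<close>
  have "slot_number i < m + 1" for i :: 'k
    using slot_number_bij[where 'k = 'k] k by (auto simp: bij_betw_def)
  then have "((prolongation s :: real \<Rightarrow> ('h, 'k) jet) has_vector_derivative
      mk_jet 1 (\<lambda>k. nth_derivative (Suc k) s \<theta>)) (at \<theta>)"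
    unfolding prolongation_def mk_jet_def
    by (intro has_vector_derivative_Pair has_vector_derivative_id has_vector_derivative_vec_lambda
        has_vector_derivative_nth_derivative[OF s])
  moreover have "mk_jet 1 (\<lambda>k. nth_derivative (Suc k) s \<theta>) =
      (total_derivative m (prolongation s \<theta>) + d_slot m (nth_derivative (m + 1) s \<theta>) :: ('h, 'k) jet)"
    using k by (auto intro!: jet_eqI simp: prolongation_def)
  ultimately show ?thesis
    by simp
qed

theorem proposition2p1:
  fixes M :: "'a measure"
    and cls :: "('a \<Rightarrow> real) \<Rightarrow> 'h::{real_inner,complete_space}"
    and m :: nat
    and s :: "real \<Rightarrow> 'h"
  assumes "is_L2_space M cls"
    and "m \<ge> 1"
    and "CARD('k::{finite,linorder}) = m + 1"
    and "CARD('l::{finite,linorder}) = m"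
    and "times_differentiable (m + 1) s"
  shows "let H = horizontal m :: ('h, 'k) jet \<Rightarrow> ('h, 'k) jet set;
             V = vertical (jet_proj :: ('h, 'k) jet \<Rightarrow> ('h, 'l) jet)
         in (\<forall>p. direct_sum_decomposition (H p) (V p)) \<and>
            (\<forall>\<theta>. let p = prolongation s \<theta>;
                     XH = total_derivative m p;
                     XV = d_slot m (nth_derivative (m + 1) s \<theta>)
                 in (prolongation s has_vector_derivative XH + XV) (at \<theta>) \<and>
                    XH \<in> H p \<and> XV \<in> V p \<and>
                    (\<forall>YH \<in> H p. \<forall>YV \<in> V p.
                       vector_derivative (prolongation s) (at \<theta>) = YH + YV \<longrightarrow>
                       YH = XH \<and> YV = XV))"
proof -
  note k = assms(3) and l = assms(4)
  note direct_sum = direct_sum_horizontal_vertical[where 'h = 'h, OF k l]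
  have H: "total_derivative m p \<in> horizontal m p" for p :: "('h, 'k) jet"
    by (simp add: horizontal_def span_base)
  have V: "d_slot m h \<in> vertical (jet_proj :: ('h, 'k) jet \<Rightarrow> ('h, 'l) jet) p" for p h
    using k l by (simp add: vertical_jet_proj)
  note deriv = has_vector_derivative_prolongation[OF k assms(5)]
  show ?thesis
    \<comment> \<open>Replacing the velocity by its computed value turns the premise of uniqueness
      into an equality of two decompositions.\<close>
    unfolding Let_def vector_derivative_at[OF deriv]
  proof (intro conjI allI ballI impI direct_sum deriv H V)
    fix \<theta> YH YV
    let ?p = "prolongation s \<theta> :: ('h, 'k) jet"
    assume "YH \<in> horizontal m ?p" "YV \<in> vertical (jet_proj :: ('h, 'k) jet \<Rightarrow> ('h, 'l) jet) ?p"
      and "total_derivative m ?p + d_slot m (nth_derivative (m + 1) s \<theta>) = YH + YV"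
    from direct_sum_decomposition_unique[OF direct_sum H this(1) V this(2,3)]
    show "YH = total_derivative m ?p" "YV = d_slot m (nth_derivative (m + 1) s \<theta>)"
      by simp_all
  qed
qed

end
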